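(* Let $A(\mu)\in\mathbb{R}^{n\times n}$ be the coefficient matrix of the parameterized linear system $A(\mu)x(\mu)=b$, with $b\in\mathbb{R}^n$ and parameter $\mu\in\mathbb{R}$, and let $$P(\mu)=P_0\tau_0(\mu)+\cdots+P_d\tau_d(\mu),\qquad P_\ell\in\mathbb{R}^{n\times n},$$ be its Chebyshev approximation on $[-a,a]$, such that the linear system $P(\mu)\tilde{x}(\mu)=b$ has a unique solution $\tilde{x}(\mu)\in\mathbb{R}^n$. Then the $dn\times dn$ linear system $$(K-\mu M)\,u(\mu)=\tilde{b},$$ with $K$, $M$ and $\tilde b$ the matrices and vector of the companion linearization defined in the context, has a unique solution. This solution has the form $u(\mu)=\begin{bmatrix}u_0(\mu)^T&\cdots&u_{d-1}(\mu)^T\end{bmatrix}^T$ with blocks $$u_\ell(\mu)=\tau_\ell(\mu)\,\tilde{x}(\mu)\in\mathbb{R}^n,\qquad \ell=0,\ldots,d-1.$$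
   Context: Let $a>0$ be real and let $n\ge 1$, $d\ge 2$ be integers. The Chebyshev polynomials on $[-a,a]$ are defined by $\tau_0(\mu)=1$, $\tau_1(\mu)=\mu/a$, $\tau_{\ell+1}(\mu)=\frac{2}{a}\mu\,\tau_\ell(\mu)-\tau_{\ell-1}(\mu)$. The matrix polynomial $P(\mu)$ approximates $A(\mu)$ in the sense that $P(\mu_\ell^* )=A(\mu_\ell^* )$ at the $d$ roots $\mu_1^*,\ldots,\mu_d^*$ of $\tau_d$. Companion linearization: $K,M\in\mathbb{R}^{dn\times dn}$ are partitioned into $d\times d$ blocks of size $n\times n$, and the vectors in $\mathbb{R}^{dn}$ are partitioned conformally into $d$ blocks of length $n$, indexed $0,\ldots,d-1$; $I$ is the $n\times n$ identity. - The first block row of $K$ is $[\,0\ \ I\ \ 0\ \cdots\ 0\,]$. - For $i=2,\ldots,d-1$, the $i$th block row of $K$ has $I$ in block columns $i-1$ and $i+1$ and zeros elsewhere. - The last (the $d$th) block row of $K$ is $[\,P_0\ \ P_1\ \cdots\ P_{d-3}\ \ (-P_d+P_{d-2})\ \ P_{d-1}\,]$. - $M=\frac{1}{a}\,\mathrm{blkdiag}(I,2I,\ldots,2I,-2P_d)$, with $d$ diagonal blocks. - $\tilde{b}\in\mathbb{R}^{dn}$ has its first $d-1$ blocks equal to zero and its last block equal to $b$. With this notation the first block equation is $u_1-\frac{\mu}{a}u_0=0$, the $i$th block equation is $u_{i-2}-\frac{2\mu}{a}u_{i-1}+u_i=0$ for $2\le i\le d-1$, and the last one is $P_0u_0+\cdots+P_{d-3}u_{d-3}+(-P_d+P_{d-2})u_{d-2}+\left(P_{d-1}+\frac{2\mu}{a}P_d\right)u_{d-1}=b$.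 *)

theory Defs
  imports Complex_Main "Jordan_Normal_Form.Matrix"
begin

fun chebyshev :: "real \<Rightarrow> nat \<Rightarrow> real \<Rightarrow> real" where
  "chebyshev a 0 \<mu> = 1"
| "chebyshev a (Suc 0) \<mu> = \<mu> / a"
| "chebyshev a (Suc (Suc l)) \<mu> = 2 / a * \<mu> * chebyshev a (Suc l) \<mu> - chebyshev a l \<mu>"

text \<open>\<open>P(\<mu>) = P\<^sub>0 \<tau>\<^sub>0(\<mu>) + \<dots> + P\<^sub>d \<tau>\<^sub>d(\<mu>)\<close>, written entrywise because
  the type of matrices is not in the class needed by \<open>sum\<close>.\<close>

definition cheb_matpoly :: "real \<Rightarrow> nat \<Rightarrow> nat \<Rightarrow> (nat \<Rightarrow> real mat) \<Rightarrow> real \<Rightarrow> real mat" where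
  "cheb_matpoly a n d P \<mu> = mat n n (\<lambda>(i, j). \<Sum>l\<le>d. P l $$ (i, j) * chebyshev a l \<mu>)"

text \<open>Interpolation of \<open>A\<close> at the \<open>d\<close> roots of \<open>\<tau>\<^sub>d\<close>, which are all real.\<close>

definition chebyshev_approx ::
    "real \<Rightarrow> nat \<Rightarrow> nat \<Rightarrow> (nat \<Rightarrow> real mat) \<Rightarrow> (real \<Rightarrow> real mat) \<Rightarrow> bool" where
  "chebyshev_approx a n d P A \<longleftrightarrow>
     (\<forall>\<nu>. chebyshev a d \<nu> = 0 \<longrightarrow> cheb_matpoly a n d P \<nu> = A \<nu>)"

text \<open>Block rows, block columns and blocks of vectors are all numbered from 0.\<close>

definition block_mat :: "nat \<Rightarrow> nat \<Rightarrow> (nat \<Rightarrow> nat \<Rightarrow> real mat) \<Rightarrow> real mat" where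
  "block_mat n d B =
     mat (d * n) (d * n) (\<lambda>(r, c). B (r div n) (c div n) $$ (r mod n, c mod n))"

definition vec_block :: "nat \<Rightarrow> real vec \<Rightarrow> nat \<Rightarrow> real vec" where
  "vec_block n u l = vec n (\<lambda>i. u $ (l * n + i))"

text \<open>For \<open>i = 0\<close> the condition \<open>i = j + 1\<close> is void, which gives the first block row
  \<open>[0 I 0 \<dots> 0]\<close>.\<close>

definition companion_K :: "nat \<Rightarrow> nat \<Rightarrow> (nat \<Rightarrow> real mat) \<Rightarrow> real mat" where
  "companion_K n d P = block_mat n d (\<lambda>i j.
     if i = d - 1 then (if j = d - 2 then - P d + P (d - 2) else P j)
     else if j = i + 1 \<or> i = j + 1 then 1\<^sub>m n
     else 0\<^sub>m n n)"

definition companion_M :: "real \<Rightarrow> nat \<Rightarrow> nat \<Rightarrow> (nat \<Rightarrow> real mat) \<Rightarrow> real mat" where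
  "companion_M a n d P = (1 / a) \<cdot>\<^sub>m
     diag_block_mat ([1\<^sub>m n] @ replicate (d - 2) (2 \<cdot>\<^sub>m 1\<^sub>m n) @ [(- 2) \<cdot>\<^sub>m P d])"

definition companion_rhs :: "nat \<Rightarrow> nat \<Rightarrow> real vec \<Rightarrow> real vec" where
  "companion_rhs n d b = 0\<^sub>v ((d - 1) * n) @\<^sub>v b"

end

theory Submission
  imports Defs
begin

text \<open>The first \<open>d - 1\<close> block equations are the Chebyshev recurrence, so they force
  \<open>u\<^sub>l = \<tau>\<^sub>l(\<mu>) u\<^sub>0\<close>. Given this, the terms with \<open>P\<^sub>d\<close> in the last block equation
  combine by the same recurrence to \<open>\<tau>\<^sub>d(\<mu>) P\<^sub>d u\<^sub>0\<close>, and that equation becomes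
  \<open>P(\<mu>) u\<^sub>0 = b\<close>.\<close>

section \<open>Vectors split into blocks of equal length\<close>

lemma block_index_less:
  fixes i k n d :: nat
  assumes "i < d" "k < n"
  shows "i * n + k < d * n"
proof -
  have "i * n + k < Suc i * n" using assms by simp
  also have "\<dots> \<le> d * n" using assms by (intro mult_le_mono1) simp
  finally show ?thesis .
qed

lemma dim_vec_block [simp]: "dim_vec (vec_block n u l) = n"
  by (simp add: vec_block_def)

lemma vec_block_carrier [simp]: "vec_block n u l \<in> carrier_vec n"
  by (simp add: carrier_vecI)

lemma index_vec_block: "k < n \<Longrightarrow> vec_block n u l $ k = u $ (l * n + k)"
  by (simp add: vec_block_def)

text \<open>Position \<open>r\<close> sits in block \<open>r div n\<close> at offset
  \<open>r mod n\<close>, so the blocks determine the vector. This serves both to verify the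
  constructed solution and to exclude any other.\<close>

lemma eq_vec_blockI:
  assumes "u \<in> carrier_vec (d * n)" "v \<in> carrier_vec (d * n)"
    and "\<And>i. i < d \<Longrightarrow> vec_block n u i = vec_block n v i"
  shows "u = v"
proof (rule eq_vecI)
  fix r assume "r < dim_vec v"
  then have r: "r < d * n" using assms by simp
  \<comment> \<open>For \<open>n = 0\<close> there is no index below \<open>d * n\<close>;
    positivity is what makes \<open>r mod n < n\<close> available.\<close>
  then have "n > 0" by (cases n) auto
  with r have "r div n < d" "r mod n < n" by (auto simp: less_mult_imp_div_less)
  from arg_cong[OF assms(3)[OF this(1)], of "\<lambda>x. x $ (r mod n)"] this(2)
  show "u $ r = v $ r" by (simp add: index_vec_block)
qed (use assms in auto)

text \<open>Allows a vector to be assembled from prescribed blocks; the solution of the companion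
  system is built this way.\<close>

lemma vec_block_vec:
  assumes "l < d" "\<And>j. j < d \<Longrightarrow> w j \<in> carrier_vec n"
  shows "vec_block n (vec (d * n) (\<lambda>r. w (r div n) $ (r mod n))) l = w l"
proof (rule eq_vecI)
  have w: "dim_vec (w l) = n" using assms by auto
  fix k assume "k < dim_vec (w l)"
  then show "vec_block n (vec (d * n) (\<lambda>r. w (r div n) $ (r mod n))) l $ k = w l $ k"
    using assms(1) w by (simp add: block_index_less index_vec_block)
qed (use assms(2)[OF assms(1)] in simp)

lemma vec_block_companion_rhs:
  assumes "b \<in> carrier_vec n" "i < d"
  shows "vec_block n (companion_rhs n d b) i = (if i = d - 1 then b else 0\<^sub>v n)"
proof (rule eq_vecI)
  fix k assume "k < dim_vec (if i = d - 1 then b else 0\<^sub>v n)"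
  then have k: "k < n" using assms by (auto split: if_splits)
  \<comment> \<open>The bound has this form because \<open>companion_rhs\<close> concatenates parts
    of lengths \<open>(d - 1) * n\<close> and \<open>n\<close>.\<close>
  have lt: "i * n + k < (d - 1) * n + n"
    using block_index_less[OF assms(2) k] assms(2) by (cases d) auto
  \<comment> \<open>Every block before the last lies entirely in the zero part.\<close>
  have "i * n + k < (d - 1) * n" if "i \<noteq> d - 1"
    using that assms(2) k by (intro block_index_less) auto
  then show "vec_block n (companion_rhs n d b) i $ k = (if i = d - 1 then b else 0\<^sub>v n) $ k"
    using assms(1) k lt by (auto simp: companion_rhs_def index_vec_block)
qed (use assms in auto)

section \<open>Entries of block matrices and their products with block vectors\<close>

text \<open>Induction on the list: the head is the upper left block of a two by two block matrix,
  and the tail is the lower right one with both block indices shifted by one. Dimensions and entries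
  are proved together, since reading an entry requires the dimensions of the tail.\<close>

lemma diag_block_mat_uniform:
  assumes "\<And>i. i < length Bs \<Longrightarrow> Bs ! i \<in> carrier_mat n n"
  shows "diag_block_mat Bs \<in> carrier_mat (length Bs * n) (length Bs * n)"
    and "\<lbrakk>i < length Bs; j < length Bs; k < n; m < n\<rbrakk> \<Longrightarrow>
      diag_block_mat Bs $$ (i * n + k, j * n + m) = (if i = j then Bs ! i $$ (k, m) else 0)"
proof -
  have "diag_block_mat Bs \<in> carrier_mat (length Bs * n) (length Bs * n) \<and>
    (\<forall>i < length Bs. \<forall>j < length Bs. \<forall>k < n. \<forall>m < n.
      diag_block_mat Bs $$ (i * n + k, j * n + m) = (if i = j then Bs ! i $$ (k, m) else 0))"
    using assms
  proof (induction Bs)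
    case Nil
    then show ?case by auto
  next
    case (Cons B Bs)
    have B: "B \<in> carrier_mat n n" using Cons.prems[of 0] by simp
    have "Bs ! i \<in> carrier_mat n n" if "i < length Bs" for i
      using Cons.prems[of "Suc i"] that by simp
    from Cons.IH[OF this]
    have D: "diag_block_mat Bs \<in> carrier_mat (length Bs * n) (length Bs * n)"
      and E: "\<And>i j k m. \<lbrakk>i < length Bs; j < length Bs; k < n; m < n\<rbrakk> \<Longrightarrow>
        diag_block_mat Bs $$ (i * n + k, j * n + m) = (if i = j then Bs ! i $$ (k, m) else 0)"
      by auto
    have lt: "i * n + k < length Bs * n" if "i < length Bs" "k < n" for i k
      using that by (rule block_index_less)
    show ?case
    proof (intro conjI allI impI)
      show "diag_block_mat (B # Bs) \<in> carrier_mat (length (B # Bs) * n) (length (B # Bs) * n)"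
        using B D by (auto simp: Let_def)
    next
      fix i j k m
      assume "i < length (B # Bs)" "j < length (B # Bs)" "k < n" "m < n"
      then show "diag_block_mat (B # Bs) $$ (i * n + k, j * n + m) =
          (if i = j then (B # Bs) ! i $$ (k, m) else 0)"
        \<comment> \<open>Whether \<open>i\<close> and \<open>j\<close> are zero decides which of
          the four blocks contains the entry.\<close>
        using B D by (cases i; cases j) (auto simp: Let_def E lt add.assoc)
    qed
  qed
  then show "diag_block_mat Bs \<in> carrier_mat (length Bs * n) (length Bs * n)"
    and "\<lbrakk>i < length Bs; j < length Bs; k < n; m < n\<rbrakk> \<Longrightarrow>
      diag_block_mat Bs $$ (i * n + k, j * n + m) = (if i = j then Bs ! i $$ (k, m) else 0)"
    by auto
qed

lemma index_block_mat:
  assumes "i < d" "j < d" "k < n" "m < n"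
  shows "block_mat n d B $$ (i * n + k, j * n + m) = B i j $$ (k, m)"
  using assms by (simp add: block_mat_def block_index_less)

text \<open>The sum over all \<open>d * n\<close> columns is grouped into \<open>d\<close>
  consecutive runs of length \<open>n\<close>, each of which is then shifted to start at 0.\<close>

lemma index_mult_mat_vec_blocks:
  assumes "C \<in> carrier_mat (d * n) (d * n)" "u \<in> carrier_vec (d * n)" "i < d" "k < n"
  shows "(C *\<^sub>v u) $ (i * n + k) =
    (\<Sum>j<d. \<Sum>m<n. C $$ (i * n + k, j * n + m) * vec_block n u j $ m)"
proof -
  have "(C *\<^sub>v u) $ (i * n + k) = (\<Sum>c<d * n. C $$ (i * n + k, c) * u $ c)"
    using assms block_index_less[OF assms(3,4)]
    by (simp add: scalar_prod_def atLeast0LessThan)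
  also have "\<dots> = (\<Sum>j<d. \<Sum>c\<in>{j * n..<j * n + n}. C $$ (i * n + k, c) * u $ c)"
    by (rule sum.nat_group[symmetric])
  also have "\<dots> = (\<Sum>j<d. \<Sum>m<n. C $$ (i * n + k, j * n + m) * vec_block n u j $ m)"
  proof (rule sum.cong[OF refl])
    fix j
    have "(\<Sum>c\<in>{j * n..<j * n + n}. C $$ (i * n + k, c) * u $ c) =
      (\<Sum>m\<in>{0..<n}. C $$ (i * n + k, m + j * n) * u $ (m + j * n))"
      using sum.shift_bounds_nat_ivl[of "\<lambda>c. C $$ (i * n + k, c) * u $ c" 0 "j * n" n]
      by (simp add: add.commute)
    then show "(\<Sum>c\<in>{j * n..<j * n + n}. C $$ (i * n + k, c) * u $ c) =
      (\<Sum>m<n. C $$ (i * n + k, j * n + m) * vec_block n u j $ m)"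
      by (simp add: atLeast0LessThan add.commute index_vec_block)
  qed
  finally show ?thesis .
qed

section \<open>Entries of the companion pencil\<close>

lemma companion_M:
  assumes "d \<ge> 2" "P d \<in> carrier_mat n n"
  shows companion_M_carrier: "companion_M a n d P \<in> carrier_mat (d * n) (d * n)"
    and index_companion_M: "\<lbrakk>i < d; j < d; k < n; m < n\<rbrakk> \<Longrightarrow>
      companion_M a n d P $$ (i * n + k, j * n + m) =
      (if i \<noteq> j then 0 else if i = d - 1 then - 2 / a * P d $$ (k, m)
       else if k = m then (if i = 0 then 1 else 2) / a else 0)"
proof -
  let ?Bs = "[1\<^sub>m n] @ replicate (d - 2) (2 \<cdot>\<^sub>m 1\<^sub>m n) @ [(- 2) \<cdot>\<^sub>m P d]"
  have len: "length ?Bs = d" using assms(1) by simp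
  have "set ?Bs \<subseteq> carrier_mat n n" using assms(2) by auto
  then have B: "\<And>i. i < length ?Bs \<Longrightarrow> ?Bs ! i \<in> carrier_mat n n"
    using nth_mem by blast
  have D: "diag_block_mat ?Bs \<in> carrier_mat (d * n) (d * n)"
    using diag_block_mat_uniform(1)[OF B] unfolding len .
  then show "companion_M a n d P \<in> carrier_mat (d * n) (d * n)"
    unfolding companion_M_def by simp
  assume ij: "i < d" "j < d" "k < n" "m < n"
  have "diag_block_mat ?Bs $$ (i * n + k, j * n + m) = (if i = j then ?Bs ! i $$ (k, m) else 0)"
    by (rule diag_block_mat_uniform(2)[OF B]) (use ij len in auto)
  \<comment> \<open>Since \<open>d \<ge> 2\<close>, the first and the last block are distinct, so
    the order of the tests is immaterial. For \<open>d = 2\<close> the replicated middle part is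
    empty.\<close>
  moreover have "?Bs ! i = (if i = 0 then 1\<^sub>m n else if i = d - 1 then (- 2) \<cdot>\<^sub>m P d else 2 \<cdot>\<^sub>m 1\<^sub>m n)"
    using assms(1) ij(1) by (cases i) (auto simp: nth_append)
  moreover have "i * n + k < d * n" "j * n + m < d * n"
    using ij by (auto intro: block_index_less)
  ultimately show "companion_M a n d P $$ (i * n + k, j * n + m) =
      (if i \<noteq> j then 0 else if i = d - 1 then - 2 / a * P d $$ (k, m)
       else if k = m then (if i = 0 then 1 else 2) / a else 0)"
    using D assms ij by (auto simp: companion_M_def)
qed

lemma companion_carrier:
  assumes "d \<ge> 2" "P d \<in> carrier_mat n n"
  shows "companion_K n d P - \<mu> \<cdot>\<^sub>m companion_M a n d P \<in> carrier_mat (d * n) (d * n)"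
  using companion_M_carrier[of d P n a] assms by (intro minus_carrier_mat smult_carrier_mat)

text \<open>The special blocks appear as added corrections rather than as nested cases, so that a
  sum over \<open>j\<close> splits into a few sums with a single nonzero term each. The sign in
  \<open>- 2 * P d\<close> turns the contribution of \<open>M\<close> to the last row
  positive.\<close>

lemma index_companion:
  assumes "d \<ge> 2" "\<forall>l\<le>d. P l \<in> carrier_mat n n"
    and "i < d" "j < d" "k < n" "m < n"
  shows "(companion_K n d P - \<mu> \<cdot>\<^sub>m companion_M a n d P) $$ (i * n + k, j * n + m) =
    (if i = d - 1
     then P j $$ (k, m) - (if j = d - 2 then P d $$ (k, m) else 0)
       + (if j = d - 1 then 2 * \<mu> / a * P d $$ (k, m) else 0)
     else if k = m
     then (if j = Suc i then 1 else 0) + (if i = Suc j then 1 else 0)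
       - (if j = i then (if i = 0 then 1 else 2) * \<mu> / a else 0)
     else 0)"
proof -
  have Pd: "P d \<in> carrier_mat n n" "P (d - 2) \<in> carrier_mat n n" using assms(2) by auto
  have r: "i * n + k < d * n" "j * n + m < d * n" using assms by (auto intro: block_index_less)
  have "companion_K n d P $$ (i * n + k, j * n + m) =
      (if i = d - 1 then (if j = d - 2 then - P d + P (d - 2) else P j)
       else if j = i + 1 \<or> i = j + 1 then 1\<^sub>m n else 0\<^sub>m n n) $$ (k, m)"
    unfolding companion_K_def by (rule index_block_mat[OF assms(3-6)])
  then show ?thesis
    using r assms(1,3-6) Pd companion_M_carrier[of d P n a, OF assms(1) Pd(1)]
      index_companion_M[of d P n, OF assms(1) Pd(1) assms(3-6), of a] by auto
qed

section \<open>Block rows of the companion system\<close>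

context
  fixes a \<mu> :: real and n d :: nat and P :: "nat \<Rightarrow> real mat" and u :: "real vec"
  assumes d: "d \<ge> 2" and P: "\<forall>l\<le>d. P l \<in> carrier_mat n n"
    and u: "u \<in> carrier_vec (d * n)"
begin

text \<open>All blocks in such a row are multiples of the identity, so each coordinate
  \<open>k\<close> is treated separately.\<close>

lemma companion_interior_row:
  assumes "Suc i < d"
  shows "vec_block n ((companion_K n d P - \<mu> \<cdot>\<^sub>m companion_M a n d P) *\<^sub>v u) i =
    vec n (\<lambda>k. vec_block n u (Suc i) $ k + (if i = 0 then 0 else vec_block n u (i - 1) $ k)
      - (if i = 0 then 1 else 2) * \<mu> / a * vec_block n u i $ k)"
proof (rule eq_vecI)
  fix k
  assume "k < dim_vec (vec n (\<lambda>k. vec_block n u (Suc i) $ k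
      + (if i = 0 then 0 else vec_block n u (i - 1) $ k)
      - (if i = 0 then 1 else 2) * \<mu> / a * vec_block n u i $ k))"
  then have k: "k < n" by simp
  have i: "i < d" "i \<noteq> d - 1" using assms by auto
  let ?C = "companion_K n d P - \<mu> \<cdot>\<^sub>m companion_M a n d P"
  let ?w = "\<lambda>j. vec_block n u j $ k"
  let ?c = "\<lambda>j. (if j = Suc i then 1 else 0) + (if i = Suc j then 1 else 0)
       - (if j = i then (if i = 0 then 1 else 2) * \<mu> / a else 0)"
  have "(?C *\<^sub>v u) $ (i * n + k) =
      (\<Sum>j<d. \<Sum>m<n. ?C $$ (i * n + k, j * n + m) * vec_block n u j $ m)"
    using companion_carrier[of d P n] d P u i k by (intro index_mult_mat_vec_blocks) auto
  also have "\<dots> = (\<Sum>j<d. \<Sum>m<n. (if m = k then ?c j * ?w j else 0))"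
    using i k by (intro sum.cong refl, subst index_companion[OF d P]) auto
  also have "\<dots> = (\<Sum>j<d. ?c j * ?w j)"
    using k by (subst sum.delta) auto
  \<comment> \<open>The guard \<open>i \<noteq> 0\<close> matters: natural subtraction would
    otherwise make \<open>i - 1\<close> the block 0 itself in the first row.\<close>
  also have "\<dots> = (\<Sum>j<d. (if j = Suc i then ?w j else 0))
      + (\<Sum>j<d. (if i \<noteq> 0 \<and> j = i - 1 then ?w j else 0))
      - (\<Sum>j<d. (if j = i then (if i = 0 then 1 else 2) * \<mu> / a * ?w j else 0))"
    unfolding sum.distrib[symmetric] sum_subtractf[symmetric]
    by (intro sum.cong refl) auto
  also have "\<dots> = ?w (Suc i) + (if i = 0 then 0 else ?w (i - 1))
      - (if i = 0 then 1 else 2) * \<mu> / a * ?w i"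
    using assms by (cases "i = 0") (auto simp: sum.delta)
  finally show "vec_block n (?C *\<^sub>v u) i $ k = vec n (\<lambda>k. vec_block n u (Suc i) $ k
      + (if i = 0 then 0 else vec_block n u (i - 1) $ k)
      - (if i = 0 then 1 else 2) * \<mu> / a * vec_block n u i $ k) $ k"
    using k by (simp add: index_vec_block)
qed simp

text \<open>The two terms with \<open>P d\<close> are kept apart from the sum so that the Chebyshev
  recurrence can later merge them.\<close>

lemma companion_last_row:
  "vec_block n ((companion_K n d P - \<mu> \<cdot>\<^sub>m companion_M a n d P) *\<^sub>v u) (d - 1) =
    vec n (\<lambda>k. (\<Sum>j<d. (P j *\<^sub>v vec_block n u j) $ k) - (P d *\<^sub>v vec_block n u (d - 2)) $ k
      + 2 * \<mu> / a * (P d *\<^sub>v vec_block n u (d - 1)) $ k)"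
proof (rule eq_vecI)
  fix k
  assume "k < dim_vec (vec n (\<lambda>k. (\<Sum>j<d. (P j *\<^sub>v vec_block n u j) $ k)
      - (P d *\<^sub>v vec_block n u (d - 2)) $ k
      + 2 * \<mu> / a * (P d *\<^sub>v vec_block n u (d - 1)) $ k))"
  then have k: "k < n" by simp
  have i: "d - 1 < d" using d by auto
  let ?C = "companion_K n d P - \<mu> \<cdot>\<^sub>m companion_M a n d P"
  have mv: "(\<Sum>m<n. P l $$ (k, m) * vec_block n u j $ m) = (P l *\<^sub>v vec_block n u j) $ k"
    if "l \<le> d" for l j
    using P that k by (auto simp: scalar_prod_def atLeast0LessThan)
  have "(?C *\<^sub>v u) $ ((d - 1) * n + k) =
      (\<Sum>j<d. \<Sum>m<n. ?C $$ ((d - 1) * n + k, j * n + m) * vec_block n u j $ m)"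
    using companion_carrier[of d P n] d P u i k by (intro index_mult_mat_vec_blocks) auto
  also have "\<dots> = (\<Sum>j<d. (\<Sum>m<n. P j $$ (k, m) * vec_block n u j $ m)
      - (if j = d - 2 then \<Sum>m<n. P d $$ (k, m) * vec_block n u j $ m else 0)
      + (if j = d - 1 then 2 * \<mu> / a * (\<Sum>m<n. P d $$ (k, m) * vec_block n u j $ m) else 0))"
  proof (intro sum.cong refl)
    fix j assume "j \<in> {..<d}"
    then have j: "j < d" by simp
    have "(\<Sum>m<n. ?C $$ ((d - 1) * n + k, j * n + m) * vec_block n u j $ m) =
      (\<Sum>m<n. P j $$ (k, m) * vec_block n u j $ m
        - (if j = d - 2 then P d $$ (k, m) * vec_block n u j $ m else 0)
        + (if j = d - 1 then 2 * \<mu> / a * (P d $$ (k, m) * vec_block n u j $ m) else 0))"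
      by (intro sum.cong refl, subst index_companion[OF d P i j k])
        (auto simp: algebra_simps)
    then show "(\<Sum>m<n. ?C $$ ((d - 1) * n + k, j * n + m) * vec_block n u j $ m) =
      (\<Sum>m<n. P j $$ (k, m) * vec_block n u j $ m)
      - (if j = d - 2 then \<Sum>m<n. P d $$ (k, m) * vec_block n u j $ m else 0)
      + (if j = d - 1 then 2 * \<mu> / a * (\<Sum>m<n. P d $$ (k, m) * vec_block n u j $ m) else 0)"
      by (simp add: sum.distrib sum_subtractf sum_distrib_left)
  qed
  also have "\<dots> = (\<Sum>j<d. (P j *\<^sub>v vec_block n u j) $ k) - (P d *\<^sub>v vec_block n u (d - 2)) $ k
      + 2 * \<mu> / a * (P d *\<^sub>v vec_block n u (d - 1)) $ k"
    using d by (simp add: sum.distrib sum_subtractf sum.delta mv)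
  finally show "vec_block n (?C *\<^sub>v u) (d - 1) $ k =
      vec n (\<lambda>k. (\<Sum>j<d. (P j *\<^sub>v vec_block n u j) $ k) - (P d *\<^sub>v vec_block n u (d - 2)) $ k
      + 2 * \<mu> / a * (P d *\<^sub>v vec_block n u (d - 1)) $ k) $ k"
    using k by (simp add: index_vec_block)
qed simp

end

section \<open>Chebyshev recurrence against the block equations\<close>

text \<open>Merges both recursive clauses into the shape of \<open>companion_interior_row\<close>,
  with the same special treatment of \<open>i = 0\<close>.\<close>

lemma chebyshev_Suc:
  "chebyshev a (Suc i) \<mu> = (if i = 0 then 1 else 2) * \<mu> / a * chebyshev a i \<mu>
    - (if i = 0 then 0 else chebyshev a (i - 1) \<mu>)"
  by (cases i) auto

lemma index_cheb_matpoly_mult_vec: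
  assumes "\<forall>l\<le>d. P l \<in> carrier_mat n n" "y \<in> carrier_vec n" "k < n"
  shows "(cheb_matpoly a n d P \<mu> *\<^sub>v y) $ k = (\<Sum>l\<le>d. chebyshev a l \<mu> * (P l *\<^sub>v y) $ k)"
proof -
  have "(cheb_matpoly a n d P \<mu> *\<^sub>v y) $ k =
      (\<Sum>m<n. \<Sum>l\<le>d. chebyshev a l \<mu> * (P l $$ (k, m) * y $ m))"
    using assms(2,3)
    by (simp add: cheb_matpoly_def scalar_prod_def atLeast0LessThan sum_distrib_left mult_ac)
  also have "\<dots> = (\<Sum>l\<le>d. \<Sum>m<n. chebyshev a l \<mu> * (P l $$ (k, m) * y $ m))"
    by (rule sum.swap)
  also have "\<dots> = (\<Sum>l\<le>d. chebyshev a l \<mu> * (P l *\<^sub>v y) $ k)"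
  proof (intro sum.cong refl)
    fix l assume "l \<in> {..d}"
    then show "(\<Sum>m<n. chebyshev a l \<mu> * (P l $$ (k, m) * y $ m)) =
        chebyshev a l \<mu> * (P l *\<^sub>v y) $ k"
      using assms(1) assms(2,3)
      by (auto simp: scalar_prod_def atLeast0LessThan sum_distrib_left)
  qed
  finally show ?thesis .
qed

text \<open>The two extra terms contribute the factor \<open>2 * \<mu> / a * chebyshev a (d - 1)
  \<mu> - chebyshev a (d - 2) \<mu>\<close> of \<open>P d\<close>, which supplies the missing top
  term of the matrix polynomial. Leaving \<open>y\<close> free permits
  \<open>y = vec_block n u 0\<close> for uniqueness and \<open>y = xt\<close> for existence.\<close>

lemma companion_last_row_chebyshev:
  assumes "d \<ge> 2" "\<forall>l\<le>d. P l \<in> carrier_mat n n" "u \<in> carrier_vec (d * n)"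
    and y: "y \<in> carrier_vec n"
    and w: "\<And>l. l < d \<Longrightarrow> vec_block n u l = chebyshev a l \<mu> \<cdot>\<^sub>v y"
  shows "vec_block n ((companion_K n d P - \<mu> \<cdot>\<^sub>m companion_M a n d P) *\<^sub>v u) (d - 1) =
    cheb_matpoly a n d P \<mu> *\<^sub>v y"
proof (rule eq_vecI)
  fix k assume "k < dim_vec (cheb_matpoly a n d P \<mu> *\<^sub>v y)"
  then have k: "k < n" by (simp add: cheb_matpoly_def)
  have mv: "(P l *\<^sub>v vec_block n u j) $ k = chebyshev a j \<mu> * (P l *\<^sub>v y) $ k"
    if "l \<le> d" "j < d" for l j
  proof -
    have "P l \<in> carrier_mat n n" using assms(2) that(1) by blast
    then show ?thesis using y k w[OF that(2)] by (simp add: mult_mat_vec[of _ n n])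
  qed
  \<comment> \<open>Here \<open>d \<ge> 2\<close> ensures that the general recurrence applies, with
    its factor 2.\<close>
  have rec: "chebyshev a d \<mu> = 2 * \<mu> / a * chebyshev a (d - 1) \<mu> - chebyshev a (d - 2) \<mu>"
    using chebyshev_Suc[of a "d - 1" \<mu>] assms(1) by (simp add: numeral_2_eq_2)
  have "(\<Sum>j<d. (P j *\<^sub>v vec_block n u j) $ k) - (P d *\<^sub>v vec_block n u (d - 2)) $ k
      + 2 * \<mu> / a * (P d *\<^sub>v vec_block n u (d - 1)) $ k =
      (\<Sum>j<d. chebyshev a j \<mu> * (P j *\<^sub>v y) $ k) + chebyshev a d \<mu> * (P d *\<^sub>v y) $ k"
    using assms(1) by (simp add: mv rec algebra_simps)
  also have "\<dots> = (cheb_matpoly a n d P \<mu> *\<^sub>v y) $ k"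
    by (simp add: index_cheb_matpoly_mult_vec[OF assms(2) y k] flip: lessThan_Suc_atMost)
  finally show "vec_block n ((companion_K n d P - \<mu> \<cdot>\<^sub>m companion_M a n d P) *\<^sub>v u) (d - 1) $ k =
      (cheb_matpoly a n d P \<mu> *\<^sub>v y) $ k"
    unfolding companion_last_row[OF assms(1-3)] using k by simp
qed (simp add: cheb_matpoly_def)

text \<open>Block equation \<open>i\<close>, solved for block \<open>Suc i\<close>, is the Chebyshev
  recurrence. Strong induction is used because the recurrence reaches back two blocks.\<close>

lemma companion_interior_zero_imp_chebyshev:
  assumes "d \<ge> 2" "\<forall>l\<le>d. P l \<in> carrier_mat n n" "u \<in> carrier_vec (d * n)"
    and zero: "\<And>i. Suc i < d \<Longrightarrow>
      vec_block n ((companion_K n d P - \<mu> \<cdot>\<^sub>m companion_M a n d P) *\<^sub>v u) i = 0\<^sub>v n"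
  shows "l < d \<Longrightarrow> vec_block n u l = chebyshev a l \<mu> \<cdot>\<^sub>v vec_block n u 0"
proof (induction l rule: less_induct)
  case (less l)
  show ?case
  proof (cases l)
    case 0
    then show ?thesis by simp
  next
    case (Suc i)
    show ?thesis
    proof (rule eq_vecI)
      fix k assume "k < dim_vec (chebyshev a l \<mu> \<cdot>\<^sub>v vec_block n u 0)"
      then have k: "k < n" by simp
      have w: "vec_block n u j $ k = chebyshev a j \<mu> * vec_block n u 0 $ k" if "j < l" for j
        using less.IH[OF that] less.prems that k by (metis dim_vec_block index_smult_vec(1) less_trans)
      have "Suc i < d" using Suc less.prems by simp
      from arg_cong[OF zero[OF this], of "\<lambda>x. x $ k"] k
      have "vec_block n u (Suc i) $ k = (if i = 0 then 1 else 2) * \<mu> / a * vec_block n u i $ k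
          - (if i = 0 then 0 else vec_block n u (i - 1) $ k)"
        unfolding companion_interior_row[OF assms(1-3) \<open>Suc i < d\<close>] by (simp split: if_splits)
      also have "\<dots> = chebyshev a (Suc i) \<mu> * vec_block n u 0 $ k"
        unfolding chebyshev_Suc[of a i] using Suc w[of i] w[of "i - 1"]
        by (cases "i = 0") (simp_all add: algebra_simps)
      finally show "vec_block n u l $ k = (chebyshev a l \<mu> \<cdot>\<^sub>v vec_block n u 0) $ k"
        using Suc k by simp
    qed simp
  qed
qed

section \<open>Existence, uniqueness and form of the solution\<close>

theorem theorem2p1:
  fixes a \<mu> :: real and n d :: nat
    and A :: "real \<Rightarrow> real mat" and P :: "nat \<Rightarrow> real mat"
    and b xt :: "real vec"
  assumes "a > 0" and "n \<ge> 1" and "d \<ge> 2"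
    and "\<And>\<nu>. A \<nu> \<in> carrier_mat n n"
    and "b \<in> carrier_vec n"
    and "\<And>l. l \<le> d \<Longrightarrow> P l \<in> carrier_mat n n"
    and "chebyshev_approx a n d P A"
    and "xt \<in> carrier_vec n"
    and "cheb_matpoly a n d P \<mu> *\<^sub>v xt = b"
    and "\<And>y. y \<in> carrier_vec n \<Longrightarrow> cheb_matpoly a n d P \<mu> *\<^sub>v y = b \<Longrightarrow> y = xt"
  shows "(\<exists>!u. u \<in> carrier_vec (d * n) \<and>
            (companion_K n d P - \<mu> \<cdot>\<^sub>m companion_M a n d P) *\<^sub>v u = companion_rhs n d b) \<and>
         (\<forall>u. u \<in> carrier_vec (d * n) \<and>
            (companion_K n d P - \<mu> \<cdot>\<^sub>m companion_M a n d P) *\<^sub>v u = companion_rhs n d b \<longrightarrow>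
            (\<forall>l<d. vec_block n u l = chebyshev a l \<mu> \<cdot>\<^sub>v xt))"
proof -
  let ?C = "companion_K n d P - \<mu> \<cdot>\<^sub>m companion_M a n d P"
  let ?sol = "\<lambda>u. u \<in> carrier_vec (d * n) \<and> ?C *\<^sub>v u = companion_rhs n d b"
  have P: "\<forall>l\<le>d. P l \<in> carrier_mat n n" using assms(6) by blast
  have C: "?C \<in> carrier_mat (d * n) (d * n)" using assms(3) P by (intro companion_carrier) auto
  \<comment> \<open>This holds for an arbitrary solution, so it gives the claimed form and, as the
    blocks are then fixed, uniqueness as well.\<close>
  have blocks: "vec_block n u l = chebyshev a l \<mu> \<cdot>\<^sub>v xt" if "?sol u" "l < d" for u l
  proof -
    have rhs: "vec_block n (?C *\<^sub>v u) i = (if i = d - 1 then b else 0\<^sub>v n)" if "i < d" for i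
      using \<open>?sol u\<close> vec_block_companion_rhs[OF assms(5) that] by simp
    have cheb: "vec_block n u l = chebyshev a l \<mu> \<cdot>\<^sub>v vec_block n u 0" if "l < d" for l
      using \<open>?sol u\<close> rhs by (intro companion_interior_zero_imp_chebyshev[OF assms(3) P _ _ that]) auto
    have "cheb_matpoly a n d P \<mu> *\<^sub>v vec_block n u 0 = b"
      using companion_last_row_chebyshev[OF assms(3) P _ _ cheb]
        \<open>?sol u\<close> rhs[of "d - 1"] assms(3) by simp
    \<comment> \<open>The assumed uniqueness for \<open>P(\<mu>)\<close> identifies the block that
      the recurrence leaves free.\<close>
    then have "vec_block n u 0 = xt" by (intro assms(10)) simp_all
    with cheb[OF \<open>l < d\<close>] show ?thesis by simp
  qed
  \<comment> \<open>The witness stacks exactly the blocks forced by \<open>blocks\<close>.\<close>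
  define v where "v = vec (d * n) (\<lambda>r. (chebyshev a (r div n) \<mu> \<cdot>\<^sub>v xt) $ (r mod n))"
  have v: "v \<in> carrier_vec (d * n)" by (simp add: v_def)
  have vb: "vec_block n v l = chebyshev a l \<mu> \<cdot>\<^sub>v xt" if "l < d" for l
    unfolding v_def using that assms(8) by (intro vec_block_vec) auto
  have "?C *\<^sub>v v = companion_rhs n d b"
  proof (rule eq_vec_blockI[of _ d n])
    show "?C *\<^sub>v v \<in> carrier_vec (d * n)" using C v by (rule mult_mat_vec_carrier)
    have "(d - 1) * n + n = d * n" using assms(3) by (cases d) auto
    moreover have "companion_rhs n d b \<in> carrier_vec ((d - 1) * n + n)"
      unfolding companion_rhs_def using assms(5) by (intro append_carrier_vec) auto
    ultimately show "companion_rhs n d b \<in> carrier_vec (d * n)" by simp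
  next
    fix i assume i: "i < d"
    show "vec_block n (?C *\<^sub>v v) i = vec_block n (companion_rhs n d b) i"
    proof (cases "i = d - 1")
      case True
      then show ?thesis
        unfolding vec_block_companion_rhs[OF assms(5) i]
        using companion_last_row_chebyshev[OF assms(3) P v assms(8) vb] assms(9) by simp
    next
      case False
      then have "Suc i < d" using i by simp
      \<comment> \<open>In each coordinate this is the Chebyshev recurrence multiplied by
        \<open>xt $ k\<close>.\<close>
      have "vec_block n (?C *\<^sub>v v) i = 0\<^sub>v n"
        unfolding companion_interior_row[OF assms(3) P v \<open>Suc i < d\<close>]
      proof (rule eq_vecI)
        fix k assume "k < dim_vec (0\<^sub>v n :: real vec)"
        then have k: "k < n" by simp
        then have w: "vec_block n v l $ k = chebyshev a l \<mu> * xt $ k" if "l < d" for l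
          using vb[OF that] assms(8) by simp
        show "vec n (\<lambda>k. vec_block n v (Suc i) $ k + (if i = 0 then 0 else vec_block n v (i - 1) $ k)
            - (if i = 0 then 1 else 2) * \<mu> / a * vec_block n v i $ k) $ k = 0\<^sub>v n $ k"
          using k w[of i] w[of "i - 1"] w[of "Suc i"] \<open>Suc i < d\<close> chebyshev_Suc[of a i \<mu>]
          by (cases "i = 0") (simp_all add: algebra_simps)
      qed simp
      then show ?thesis using vec_block_companion_rhs[OF assms(5) i] False by simp
    qed
  qed
  with v have "?sol v" by simp
  moreover have "u = v" if "?sol u" for u
    using that v blocks vb by (intro eq_vec_blockI[of u d n v]) auto
  ultimately show ?thesis using blocks by blast
qed

end
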